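(* Let $\boldsymbol{s} = (s_1,\dots,s_d)$ be a centered isotropic sub-Gaussian random vector in $\mathbb{R}^d$. Let $\mathcal{S} := \{k_1,\dots,k_S\}\subset\{1,\dots,d\}$ be a set of $S$ (pairwise distinct) indices, and let $y = G(s_{k_1},\dots,s_{k_S})$ be a sub-Gaussian random variable, where $G\colon\mathbb{R}^S\to\mathbb{R}$ is a measurable function which may be random (independently of $\boldsymbol{s}$). Set $$ T := \operatorname{span}\{\boldsymbol{e}_{k_1},\dots,\boldsymbol{e}_{k_S}\} = \{\boldsymbol{z}\in\mathbb{R}^d : \operatorname{supp}(\boldsymbol{z})\subset\mathcal{S}\}. $$ Then $\boldsymbol{z}^\natural := \sum_{j=1}^S \mu_j\boldsymbol{e}_{k_j}\in T$ with $$ \mu_j := \mathbb{E}[G(s_{k_1},\dots,s_{k_S})\,s_{k_j}],\quad j=1,\dots,S, $$ minimizes the mismatch covariance $\rho$ on $T$, and we have $$ \rho(\boldsymbol{z}^\natural) = \big\|\mathbb{E}[G(s_{k_1},\dots,s_{k_S})\,\boldsymbol{P}_T^\perp\boldsymbol{s}]\big\|_2 . $$ If the feature variables $s_1,\dots,s_d$ of $\boldsymbol{s}$ are independent, we particularly have $\rho(\boldsymbol{z}^\natural)=0$.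
   Context: A real random variable $v$ is sub-Gaussian if $\|v\|_{\psi_2} := \sup_{q\ge 1} q^{-1/2}(\mathbb{E}|v|^q)^{1/q}<\infty$; a random vector $\boldsymbol{v}$ in $\mathbb{R}^d$ is sub-Gaussian if $\sup_{\boldsymbol{u}\in\mathbb{S}^{d-1}}\|\langle\boldsymbol{v},\boldsymbol{u}\rangle\|_{\psi_2}<\infty$, centered if $\mathbb{E}[\boldsymbol{v}]=\boldsymbol{0}$, and isotropic if $\mathbb{E}[\boldsymbol{v}\boldsymbol{v}^{\mathsf T}]=\boldsymbol{I}_d$. The mismatch covariance of $\boldsymbol{z}\in\mathbb{R}^d$ is $\rho(\boldsymbol{z}) := \|\mathbb{E}[(y-\langle\boldsymbol{s},\boldsymbol{z}\rangle)\boldsymbol{s}]\|_2$. $\boldsymbol{e}_k\in\mathbb{R}^d$ is the $k$-th unit vector; $\operatorname{supp}(\boldsymbol{z})$ is the index set of the non-zero entries of $\boldsymbol{z}$; $\boldsymbol{P}_T^\perp := \boldsymbol{I}_d-\boldsymbol{P}_T$, where $\boldsymbol{P}_T$ is the orthogonal projection onto $T$. That $G$ may be random, independently of $\boldsymbol{s}$, means that $G$ may additionally depend measurably on an auxiliary random element independent of $\boldsymbol{s}$. *)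

theory Defs
  imports "HOL-Probability.Probability"
begin

definition Lq_norm :: "'a measure \<Rightarrow> real \<Rightarrow> ('a \<Rightarrow> real) \<Rightarrow> ennreal" where
  "Lq_norm M q v =
     (if integrable M (\<lambda>\<omega>. \<bar>v \<omega>\<bar> powr q)
      then ennreal ((\<integral>\<omega>. \<bar>v \<omega>\<bar> powr q \<partial>M) powr (1 / q)) else \<infinity>)"

definition psi2_norm :: "'a measure \<Rightarrow> ('a \<Rightarrow> real) \<Rightarrow> ennreal" where
  "psi2_norm M v = (SUP q\<in>{1..}. ennreal (q powr (- 1 / 2)) * Lq_norm M q v)"

definition sub_gaussian :: "'a measure \<Rightarrow> ('a \<Rightarrow> real) \<Rightarrow> bool" where
  "sub_gaussian M v \<longleftrightarrow> v \<in> borel_measurable M \<and> psi2_norm M v < \<infinity>"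

definition sub_gaussian_vec :: "'a measure \<Rightarrow> ('a \<Rightarrow> real ^ 'd) \<Rightarrow> bool" where
  "sub_gaussian_vec M v \<longleftrightarrow>
     v \<in> borel_measurable M \<and> (SUP u\<in>sphere 0 1. psi2_norm M (\<lambda>\<omega>. v \<omega> \<bullet> u)) < \<infinity>"

text \<open>Existence of the expectation is part of the next two notions, since the Bochner integral
  of a non-integrable function is 0 by convention.\<close>

definition centered :: "'a measure \<Rightarrow> ('a \<Rightarrow> real ^ 'd) \<Rightarrow> bool" where
  "centered M v \<longleftrightarrow> has_bochner_integral M v 0"

definition isotropic :: "'a measure \<Rightarrow> ('a \<Rightarrow> real ^ 'd) \<Rightarrow> bool" where
  "isotropic M v \<longleftrightarrow>
     has_bochner_integral M (\<lambda>\<omega>. (\<chi> i j. v \<omega> $ i * v \<omega> $ j) :: real ^ 'd ^ 'd) (mat 1)"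

text \<open>\<open>prob_space.indep_var\<close> requires both variables to have the same codomain type, so independence
  of two general random elements is expressed through the sigma-algebras they generate.\<close>

definition indep_elements ::
    "'a measure \<Rightarrow> 'b measure \<Rightarrow> ('a \<Rightarrow> 'b) \<Rightarrow> 'c measure \<Rightarrow> ('a \<Rightarrow> 'c) \<Rightarrow> bool" where
  "indep_elements M N X L Y \<longleftrightarrow>
     X \<in> M \<rightarrow>\<^sub>M N \<and> Y \<in> M \<rightarrow>\<^sub>M L \<and>
     prob_space.indep_set M {X -` A \<inter> space M | A. A \<in> sets N} {Y -` B \<inter> space M | B. B \<in> sets L}"

definition mismatch_cov ::
    "'a measure \<Rightarrow> ('a \<Rightarrow> real ^ 'd) \<Rightarrow> ('a \<Rightarrow> real) \<Rightarrow> real ^ 'd \<Rightarrow> real" where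
  "mismatch_cov M s y z = norm (\<integral>\<omega>. (y \<omega> - s \<omega> \<bullet> z) *\<^sub>R s \<omega> \<partial>M)"

definition vec_supp :: "real ^ 'd \<Rightarrow> 'd set" where
  "vec_supp z = {i. z $ i \<noteq> 0}"

definition orth_proj :: "'v::euclidean_space set \<Rightarrow> 'v \<Rightarrow> 'v" where
  "orth_proj T x = (THE p. p \<in> T \<and> (\<forall>t\<in>T. orthogonal (x - p) t))"

definition orth_proj_perp :: "'v::euclidean_space set \<Rightarrow> 'v \<Rightarrow> 'v" where
  "orth_proj_perp T x = x - orth_proj T x"

lemma orth_proj_unique_exists:
  fixes T :: "'v::euclidean_space set"
  assumes "subspace T"
  shows "\<exists>!p. p \<in> T \<and> (\<forall>t\<in>T. orthogonal (x - p) t)"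
proof (rule ex_ex1I)
  obtain p r where "p \<in> span T" "\<And>w. w \<in> span T \<Longrightarrow> orthogonal r w" "x = p + r"
    using orthogonal_subspace_decomp_exists[of T x] by metis
  then show "\<exists>p. p \<in> T \<and> (\<forall>t\<in>T. orthogonal (x - p) t)"
    using assms by (intro exI[of _ p]) (auto simp: span_base span_eq_iff[THEN iffD2])
next
  fix p q
  assume p: "p \<in> T \<and> (\<forall>t\<in>T. orthogonal (x - p) t)"
    and q: "q \<in> T \<and> (\<forall>t\<in>T. orthogonal (x - q) t)"
  have "p - q \<in> T" using p q assms by (simp add: subspace_diff)
  then have "(x - q) \<bullet> (p - q) = 0" "(x - p) \<bullet> (p - q) = 0"
    using p q by (auto simp: orthogonal_def)
  then have "(p - q) \<bullet> (p - q) = 0" by (simp add: inner_diff_left)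
  then show "p = q" by simp
qed

end

theory Submission
  imports Defs
begin

text \<open>
  Write \<open>m = E[y s]\<close>. Since \<open>E[s s\<^sup>T]\<close> is the identity, \<open>E[(y - \<langle>s, z\<rangle>) s] = m - z\<close>, so the
  mismatch covariance of \<open>z\<close> is simply the Euclidean distance from \<open>z\<close> to \<open>m\<close>
  (\<open>mismatch_cov_eq_distance\<close>). Minimizing it over \<open>T\<close> therefore means projecting \<open>m\<close>
  orthogonally onto \<open>T\<close>. As \<open>T\<close> consists of the vectors supported on the active indices
  (\<open>span_axes_eq_supported\<close>), this projection keeps the active coordinates of \<open>m\<close> and deletes the
  others, which gives \<open>z\<^sub>0\<close>. The residual \<open>m - z\<^sub>0\<close> is the complementary projection of \<open>m\<close>, and
  it can be computed under the expectation because the projection acts coordinatewise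
  (\<open>orth_proj_perp_supported\<close>).

  The residual has the coordinates \<open>E[y s\<^sub>i]\<close> with \<open>i\<close> inactive. If the features are independent,
  then \<open>s\<^sub>i\<close> is independent of \<open>y\<close>, which is built from the active features and the external
  randomness \<open>\<xi>\<close> (\<open>indep_response_inactive_feature\<close>). Hence \<open>E[y s\<^sub>i] = E[y] E[s\<^sub>i] = 0\<close>, because
  \<open>s\<close> is centered. The only point of substance there is that two independence hypotheses, \<open>\<xi>\<close>
  against \<open>s\<close> and the features among themselves, combine into independence of the pair
  \<open>(\<xi>, active features)\<close> from \<open>s\<^sub>i\<close> (\<open>indep_pair_third\<close>).

  All these expectations exist: the sub-Gaussian bound on \<open>y\<close> yields its second moment, isotropy
  yields those of \<open>s\<close>, and so every product \<open>y s\<^sub>i\<close> is integrable.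
\<close>

section \<open>Square integrability and coordinatewise integration\<close>

text \<open>The term \<open>q = 2\<close> of the supremum defining the \<open>\<psi>\<^sub>2\<close>-norm is infinite unless the second
  moment exists.\<close>

lemma sub_gaussian_imp_square_integrable:
  assumes "sub_gaussian M v"
  shows "integrable M (\<lambda>\<omega>. (v \<omega>)\<^sup>2)"
proof (rule ccontr)
  assume nint: "\<not> integrable M (\<lambda>\<omega>. (v \<omega>)\<^sup>2)"
  have "(\<lambda>\<omega>. \<bar>v \<omega>\<bar> powr 2) = (\<lambda>\<omega>. (v \<omega>)\<^sup>2)"
    by (simp add: fun_eq_iff)
  with nint have "Lq_norm M 2 v = \<infinity>"
    by (simp add: Lq_norm_def)
  then have "ennreal (2 powr (- 1 / 2)) * Lq_norm M 2 v = \<infinity>"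
    by (simp add: ennreal_mult_eq_top_iff)
  moreover have "ennreal (2 powr (- 1 / 2)) * Lq_norm M 2 v \<le> psi2_norm M v"
    unfolding psi2_norm_def by (intro SUP_upper) auto
  ultimately show False
    using assms by (simp add: sub_gaussian_def top_unique)
qed

lemma integrable_mult_of_square_integrable:
  fixes f g :: "'a \<Rightarrow> real"
  assumes [measurable]: "f \<in> borel_measurable M" "g \<in> borel_measurable M"
    and "integrable M (\<lambda>\<omega>. (f \<omega>)\<^sup>2)" "integrable M (\<lambda>\<omega>. (g \<omega>)\<^sup>2)"
  shows "integrable M (\<lambda>\<omega>. f \<omega> * g \<omega>)"
proof (rule Bochner_Integration.integrable_bound)
  show "integrable M (\<lambda>\<omega>. (f \<omega>)\<^sup>2 + (g \<omega>)\<^sup>2)"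
    using assms by simp
  have "\<bar>a * b\<bar> \<le> a\<^sup>2 + b\<^sup>2" for a b :: real
    using sum_squares_bound[of "\<bar>a\<bar>" "\<bar>b\<bar>"] zero_le_power2[of a] zero_le_power2[of b]
      abs_ge_zero[of "a * b"]
    unfolding power2_abs abs_mult by linarith
  then show "AE \<omega> in M. norm (f \<omega> * g \<omega>) \<le> norm ((f \<omega>)\<^sup>2 + (g \<omega>)\<^sup>2)"
    by (auto intro!: AE_I2 order_trans[OF _ abs_ge_self])
qed measurable

lemma has_bochner_integral_vec_nth:
  fixes f :: "'a \<Rightarrow> 'b::euclidean_space ^ 'n"
  assumes "has_bochner_integral M f x"
  shows "has_bochner_integral M (\<lambda>\<omega>. f \<omega> $ i) (x $ i)"
  using has_bochner_integral_bounded_linear[OF bounded_linear_vec_nth assms] .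

lemma integrable_vec_componentwise:
  fixes f :: "'a \<Rightarrow> real ^ 'n"
  assumes "\<And>i. integrable M (\<lambda>\<omega>. f \<omega> $ i)"
  shows "integrable M f"
proof -
  have "integrable M (\<lambda>\<omega>. \<Sum>i\<in>UNIV. (f \<omega> $ i) *\<^sub>R (axis i 1 :: real ^ 'n))"
    using assms by simp
  moreover have "(\<lambda>\<omega>. \<Sum>i\<in>UNIV. (f \<omega> $ i) *\<^sub>R (axis i 1 :: real ^ 'n)) = f"
    using basis_expansion[where 'a = real and 'n = 'n] by (simp add: fun_eq_iff scalar_mult_eq_scaleR)
  ultimately show ?thesis by simp
qed

lemma integral_vec_nth:
  fixes f :: "'a \<Rightarrow> real ^ 'n"
  assumes "\<And>i. integrable M (\<lambda>\<omega>. f \<omega> $ i)"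
  shows "(\<integral>\<omega>. f \<omega> \<partial>M) $ i = (\<integral>\<omega>. f \<omega> $ i \<partial>M)"
  using integral_bounded_linear[OF bounded_linear_vec_nth integrable_vec_componentwise[OF assms]]
  by simp

lemma isotropic_moments:
  assumes "isotropic M s"
  shows "has_bochner_integral M (\<lambda>\<omega>. s \<omega> $ i * s \<omega> $ j) (if i = j then 1 else 0)"
  using has_bochner_integral_vec_nth[OF has_bochner_integral_vec_nth
      [OF assms[unfolded isotropic_def], of i], of j]
  by (simp add: mat_def)

section \<open>The mismatch covariance as a distance\<close>

text \<open>Isotropy turns \<open>E[\<langle>s, z\<rangle> s]\<close> into \<open>z\<close>. The integrability of the products \<open>y s\<^sub>i\<close> allows
  the expectation of the difference to be split.\<close>

lemma mismatch_cov_eq_distance: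
  fixes s :: "'a \<Rightarrow> real ^ 'd"
  assumes iso: "isotropic M s"
    and ys: "\<And>i. integrable M (\<lambda>\<omega>. y \<omega> * s \<omega> $ i)"
  shows "mismatch_cov M s y z = norm ((\<integral>\<omega>. y \<omega> *\<^sub>R s \<omega> \<partial>M) - z)"
proof -
  have hb: "has_bochner_integral M (\<lambda>\<omega>. ((y \<omega> - s \<omega> \<bullet> z) *\<^sub>R s \<omega>) $ i)
      ((\<integral>\<omega>. y \<omega> *\<^sub>R s \<omega> \<partial>M) $ i - z $ i)" for i
  proof -
    have "has_bochner_integral M
        (\<lambda>\<omega>. y \<omega> * s \<omega> $ i - (\<Sum>j\<in>UNIV. z $ j * (s \<omega> $ j * s \<omega> $ i)))
        ((\<integral>\<omega>. y \<omega> * s \<omega> $ i \<partial>M) - (\<Sum>j\<in>UNIV. z $ j * (if j = i then 1 else 0)))"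
      by (intro has_bochner_integral_diff has_bochner_integral_sum
          has_bochner_integral_mult_right isotropic_moments[OF iso]
          has_bochner_integral_integrable ys)
    moreover have "(\<Sum>j\<in>UNIV. z $ j * (if j = i then 1 else 0)) = z $ i"
      by (simp add: if_distrib cong: if_cong)
    moreover have "(\<integral>\<omega>. y \<omega> *\<^sub>R s \<omega> \<partial>M) $ i = (\<integral>\<omega>. y \<omega> * s \<omega> $ i \<partial>M)"
      by (subst integral_vec_nth) (simp_all add: ys)
    ultimately show ?thesis
      by (simp add: inner_vec_def algebra_simps sum_distrib_left)
  qed
  have "(\<integral>\<omega>. (y \<omega> - s \<omega> \<bullet> z) *\<^sub>R s \<omega> \<partial>M) = (\<integral>\<omega>. y \<omega> *\<^sub>R s \<omega> \<partial>M) - z"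
    unfolding vec_eq_iff
  proof
    fix i
    show "(\<integral>\<omega>. (y \<omega> - s \<omega> \<bullet> z) *\<^sub>R s \<omega> \<partial>M) $ i = ((\<integral>\<omega>. y \<omega> *\<^sub>R s \<omega> \<partial>M) - z) $ i"
      using has_bochner_integral_integral_eq[OF hb]
      by (subst integral_vec_nth[OF integrable.intros[OF hb]]) simp
  qed
  then show ?thesis by (simp add: mismatch_cov_def)
qed

section \<open>Coordinate subspaces\<close>

lemma subspace_supported: "subspace {z :: real ^ 'd. vec_supp z \<subseteq> K}"
  unfolding subspace_def vec_supp_def by (auto simp: subset_iff) (metis add_0)

lemma span_axes_eq_supported:
  fixes k :: "'s::finite \<Rightarrow> 'd::finite"
  shows "span (range (\<lambda>j. axis (k j) (1::real))) = {z. vec_supp z \<subseteq> range k}"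
proof
  have "range (\<lambda>j. axis (k j) 1) \<subseteq> {z :: real ^ 'd. vec_supp z \<subseteq> range k}"
    by (auto simp: vec_supp_def axis_def split: if_splits)
  then show "span (range (\<lambda>j. axis (k j) 1)) \<subseteq> {z :: real ^ 'd. vec_supp z \<subseteq> range k}"
    by (intro span_minimal subspace_supported)
next
  show "{z. vec_supp z \<subseteq> range k} \<subseteq> span (range (\<lambda>j. axis (k j) (1::real)))"
  proof
    fix z :: "real ^ 'd" assume z: "z \<in> {z. vec_supp z \<subseteq> range k}"
    have "z $ i *\<^sub>R axis i 1 \<in> span (range (\<lambda>j. axis (k j) (1::real)))" for i
    proof (cases "i \<in> range k")
      case True
      then have "axis i 1 \<in> range (\<lambda>j. axis (k j) (1::real))" by blast
      then show ?thesis by (intro span_scale span_base)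
    next
      case False
      with z have "z $ i = 0" by (auto simp: vec_supp_def)
      then show ?thesis by (simp add: span_zero)
    qed
    then have "(\<Sum>i\<in>UNIV. z $ i *\<^sub>R axis i 1) \<in> span (range (\<lambda>j. axis (k j) (1::real)))"
      by (intro span_sum)
    then show "z \<in> span (range (\<lambda>j. axis (k j) (1::real)))"
      using basis_expansion[of z] by (simp add: scalar_mult_eq_scaleR)
  qed
qed

lemma orth_proj_eqI:
  assumes "subspace T" "p \<in> T" "\<And>t. t \<in> T \<Longrightarrow> orthogonal (x - p) t"
  shows "orth_proj T x = p"
  unfolding orth_proj_def
  using assms by (intro the1_equality orth_proj_unique_exists) auto

text \<open>For a coordinate subspace the residual of the truncated vector is supported off \<open>K\<close>, so its inner
  product with any vector supported on \<open>K\<close> vanishes term by term.\<close>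

lemma orth_proj_perp_supported:
  fixes x :: "real ^ 'd"
  shows "orth_proj_perp {z. vec_supp z \<subseteq> K} x = (\<chi> i. if i \<in> K then 0 else x $ i)"
proof -
  have "orth_proj {z. vec_supp z \<subseteq> K} x = (\<chi> i. if i \<in> K then x $ i else 0)"
    by (rule orth_proj_eqI[OF subspace_supported])
      (auto simp: vec_supp_def orthogonal_def inner_vec_def intro!: sum.neutral split: if_splits)
  then show ?thesis
    by (simp add: orth_proj_perp_def vec_eq_iff)
qed

section \<open>Independence of the response from the inactive features\<close>

context prob_space
begin

text \<open>The hypotheses say that \<open>X\<close> is independent of \<open>(Y, Z)\<close> and that \<open>Y\<close> is independent of \<open>Z\<close>.
  On a rectangle both steps are applied in turn,
  \<open>P(X \<in> A, Y \<in> B, Z \<in> C) = P(X \<in> A) P(Y \<in> B) P(Z \<in> C) = P(X \<in> A, Y \<in> B) P(Z \<in> C)\<close>,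
  and since rectangles form an intersection-stable generator of the product sigma-algebra, the
  factorization extends to all its sets. Events rather than random variables are used because
  \<open>indep_var\<close> would force \<open>(X, Y)\<close> and \<open>Z\<close> to have the same codomain type.\<close>

lemma indep_pair_third:
  assumes X: "X \<in> M \<rightarrow>\<^sub>M N" and Y: "Y \<in> M \<rightarrow>\<^sub>M L" and Z: "Z \<in> M \<rightarrow>\<^sub>M K"
    and XYZ: "\<And>A B C. A \<in> sets N \<Longrightarrow> B \<in> sets L \<Longrightarrow> C \<in> sets K \<Longrightarrow>
      prob ((X -` A \<inter> space M) \<inter> ((Y -` B \<inter> space M) \<inter> (Z -` C \<inter> space M)))
        = prob (X -` A \<inter> space M) * prob ((Y -` B \<inter> space M) \<inter> (Z -` C \<inter> space M))"
    and YZ: "\<And>B C. B \<in> sets L \<Longrightarrow> C \<in> sets K \<Longrightarrow>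
      prob ((Y -` B \<inter> space M) \<inter> (Z -` C \<inter> space M))
        = prob (Y -` B \<inter> space M) * prob (Z -` C \<inter> space M)"
  shows "indep_set {(\<lambda>\<omega>. (X \<omega>, Y \<omega>)) -` D \<inter> space M | D. D \<in> sets (N \<Otimes>\<^sub>M L)}
    {Z -` C \<inter> space M | C. C \<in> sets K}"
proof -
  let ?R = "{A \<times> B | A B. A \<in> sets N \<and> B \<in> sets L}"
  let ?P = "{(\<lambda>\<omega>. (X \<omega>, Y \<omega>)) -` D \<inter> space M | D. D \<in> ?R}"
  let ?Q = "{Z -` C \<inter> space M | C. C \<in> sets K}"
  note [measurable] = X Y Z
  have rect: "(\<lambda>\<omega>. (X \<omega>, Y \<omega>)) -` (A \<times> B) \<inter> space M
      = (X -` A \<inter> space M) \<inter> (Y -` B \<inter> space M)" for A B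
    by auto
  have XY: "prob ((X -` A \<inter> space M) \<inter> (Y -` B \<inter> space M))
      = prob (X -` A \<inter> space M) * prob (Y -` B \<inter> space M)"
    if "A \<in> sets N" "B \<in> sets L" for A B
  proof -
    (* Independence of X and Y is the case C = space K of the first hypothesis. *)
    have "(Y -` B \<inter> space M) \<inter> (Z -` space K \<inter> space M) = Y -` B \<inter> space M"
      using measurable_space[OF Z] by auto
    then show ?thesis using XYZ[OF that sets.top] by simp
  qed
  have "indep_set ?P ?Q"
  proof (rule indep_setI)
    show "?P \<subseteq> events" "?Q \<subseteq> events"
      unfolding rect by (auto simp: rect)
  next
    fix a b assume "a \<in> ?P" "b \<in> ?Q"
    then obtain A B C where S: "A \<in> sets N" "B \<in> sets L" "C \<in> sets K"
      and ab: "a = (X -` A \<inter> space M) \<inter> (Y -` B \<inter> space M)" "b = Z -` C \<inter> space M"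
      using rect by fastforce
    have "prob (a \<inter> b) = prob (X -` A \<inter> space M) *
        (prob (Y -` B \<inter> space M) * prob (Z -` C \<inter> space M))"
      using XYZ[OF S] YZ[OF S(2,3)] by (simp add: ab Int_assoc)
    also have "\<dots> = prob a * prob b"
      using XY[OF S(1,2)] by (simp add: ab)
    finally show "prob (a \<inter> b) = prob a * prob b" .
  qed
  moreover have "Int_stable ?P"
  proof (rule Int_stableI)
    fix a b assume "a \<in> ?P" "b \<in> ?P"
    then obtain A B A' B' where S: "A \<in> sets N" "B \<in> sets L" "A' \<in> sets N" "B' \<in> sets L"
      and "a = (\<lambda>\<omega>. (X \<omega>, Y \<omega>)) -` (A \<times> B) \<inter> space M"
      and "b = (\<lambda>\<omega>. (X \<omega>, Y \<omega>)) -` (A' \<times> B') \<inter> space M"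
      by blast
    then have "a \<inter> b = (\<lambda>\<omega>. (X \<omega>, Y \<omega>)) -` ((A \<inter> A') \<times> (B \<inter> B')) \<inter> space M"
      by auto
    then show "a \<inter> b \<in> ?P" using S by blast
  qed
  moreover have "Int_stable ?Q"
  proof (rule Int_stableI)
    fix a b assume "a \<in> ?Q" "b \<in> ?Q"
    then obtain C C' where S: "C \<in> sets K" "C' \<in> sets K"
      and "a = Z -` C \<inter> space M" "b = Z -` C' \<inter> space M"
      by blast
    then have "a \<inter> b = Z -` (C \<inter> C') \<inter> space M" by auto
    then show "a \<inter> b \<in> ?Q" using S by blast
  qed
  ultimately have "indep_set (sigma_sets (space M) ?P) (sigma_sets (space M) ?Q)"
    by (rule indep_set_sigma_sets)
  moreover have "sigma_sets (space M) ?P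
      = {(\<lambda>\<omega>. (X \<omega>, Y \<omega>)) -` D \<inter> space M | D. D \<in> sets (N \<Otimes>\<^sub>M L)}"
    unfolding sets_pair_measure
    by (rule sigma_sets_vimage_commute[symmetric])
      (use measurable_space[OF X] measurable_space[OF Y] in auto)
  moreover have "sigma_sets (space M) ?Q = ?Q"
    using sigma_sets_vimage_commute[of Z "space M" "space K" "sets K"] measurable_space[OF Z]
    by (auto simp: sets.sigma_sets_eq)
  ultimately show ?thesis by simp
qed

text \<open>The response is a measurable function of the pair \<open>(\<xi>, s\<^sub>K)\<close>, where \<open>s\<^sub>K\<close> collects the active
  features, so it suffices that this pair is independent of \<open>s\<^sub>i\<close>.\<close>

lemma indep_response_inactive_feature:
  fixes s :: "'a \<Rightarrow> real ^ 'd" and k :: "'s::finite \<Rightarrow> 'd"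
  assumes ind: "indep_elements M N \<xi> borel s"
    and G: "(\<lambda>(c, x). G c x) \<in> borel_measurable (N \<Otimes>\<^sub>M borel)"
    and feat: "indep_vars (\<lambda>_. borel) (\<lambda>i \<omega>. s \<omega> $ i) UNIV"
    and i: "i \<notin> range k"
  shows "indep_var borel (\<lambda>\<omega>. G (\<xi> \<omega>) (\<chi> j. s \<omega> $ k j) :: real) borel (\<lambda>\<omega>. s \<omega> $ i)"
proof -
  define sK where "sK \<omega> = (\<chi> j. s \<omega> $ k j)" for \<omega>
  have xi: "\<xi> \<in> M \<rightarrow>\<^sub>M N" and s: "s \<in> borel_measurable M"
    and ind': "indep_set {\<xi> -` A \<inter> space M | A. A \<in> sets N} {s -` B \<inter> space M | B. B \<in> sets borel}"
    using ind by (auto simp: indep_elements_def)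
  have nth: "(\<lambda>x :: real ^ 'd. x $ l) \<in> borel_measurable borel" for l
    by (intro borel_measurable_continuous_onI continuous_intros)
  have sel: "(\<lambda>x :: real ^ 'd. \<chi> j. x $ k j) \<in> borel_measurable borel"
    by (intro borel_measurable_continuous_onI continuous_intros)
  have sK: "sK \<in> borel_measurable M" and si: "(\<lambda>\<omega>. s \<omega> $ i) \<in> borel_measurable M"
    unfolding sK_def using measurable_compose[OF s sel] measurable_compose[OF s nth] by auto
  have YZ: "prob ((sK -` B \<inter> space M) \<inter> ((\<lambda>\<omega>. s \<omega> $ i) -` C \<inter> space M))
      = prob (sK -` B \<inter> space M) * prob ((\<lambda>\<omega>. s \<omega> $ i) -` C \<inter> space M)"
    if B: "B \<in> sets borel" and C: "C \<in> sets borel" for B C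
  proof -
    (* Disjoint blocks of independent variables are independent as functions on the index blocks;
       ?fK and evaluation at i translate these functions back into sK and the i-th feature. *)
    let ?PK = "PiM (range k) (\<lambda>_. borel :: real measure)" and ?Pi = "PiM {i} (\<lambda>_. borel :: real measure)"
    let ?fK = "\<lambda>g. (\<chi> j. g (k j)) :: real ^ 's"
    let ?rK = "\<lambda>\<omega>. restrict (\<lambda>l. s \<omega> $ l) (range k)" and ?ri = "\<lambda>\<omega>. restrict (\<lambda>l. s \<omega> $ l) {i}"
    have iv: "indep_var ?PK ?rK ?Pi ?ri"
      using i by (intro indep_var_restrict[OF feat]) auto
    have mK: "?fK \<in> borel_measurable ?PK"
      unfolding borel_measurable_euclidean_space[of ?fK]
      by (auto simp: Basis_vec_def inner_axis)
    have mi: "(\<lambda>g. g i) \<in> borel_measurable ?Pi" by simp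
    have 1: "?rK -` (?fK -` B \<inter> space ?PK) \<inter> space M = sK -` B \<inter> space M"
      by (auto simp: sK_def space_PiM)
    have 2: "?ri -` ((\<lambda>g. g i) -` C \<inter> space ?Pi) \<inter> space M = (\<lambda>\<omega>. s \<omega> $ i) -` C \<inter> space M"
      by (auto simp: space_PiM)
    have "(\<lambda>\<omega>. (?rK \<omega>, ?ri \<omega>)) -` ((?fK -` B \<inter> space ?PK) \<times> ((\<lambda>g. g i) -` C \<inter> space ?Pi)) \<inter> space M
        = (?rK -` (?fK -` B \<inter> space ?PK) \<inter> space M) \<inter> (?ri -` ((\<lambda>g. g i) -` C \<inter> space ?Pi) \<inter> space M)"
      by blast
    with indep_varD[OF iv measurable_sets[OF mK B] measurable_sets[OF mi C]]
    show ?thesis by (simp only: 1 2)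
  qed
  have XYZ: "prob ((\<xi> -` A \<inter> space M) \<inter> ((sK -` B \<inter> space M) \<inter> ((\<lambda>\<omega>. s \<omega> $ i) -` C \<inter> space M)))
      = prob (\<xi> -` A \<inter> space M) * prob ((sK -` B \<inter> space M) \<inter> ((\<lambda>\<omega>. s \<omega> $ i) -` C \<inter> space M))"
    if A: "A \<in> sets N" and B: "B \<in> sets borel" and C: "C \<in> sets borel" for A B C
  proof (rule indep_setD[OF ind'])
    (* An event about the features alone lies in the sigma-algebra of s. *)
    let ?D = "(\<lambda>x :: real ^ 'd. \<chi> j. x $ k j) -` B \<inter> (\<lambda>x. x $ i) -` C"
    have "?D \<in> sets borel"
      using measurable_sets[OF sel B] measurable_sets[OF nth C] by auto
    moreover have "(sK -` B \<inter> space M) \<inter> ((\<lambda>\<omega>. s \<omega> $ i) -` C \<inter> space M) = s -` ?D \<inter> space M"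
      by (auto simp: sK_def)
    ultimately show "(sK -` B \<inter> space M) \<inter> ((\<lambda>\<omega>. s \<omega> $ i) -` C \<inter> space M)
        \<in> {s -` B \<inter> space M | B. B \<in> sets borel}"
      by blast
  qed (use A in blast)
  have ind3: "indep_set {(\<lambda>\<omega>. (\<xi> \<omega>, sK \<omega>)) -` D \<inter> space M | D. D \<in> sets (N \<Otimes>\<^sub>M borel)}
      {(\<lambda>\<omega>. s \<omega> $ i) -` C \<inter> space M | C. C \<in> sets borel}"
    by (rule indep_pair_third[OF xi sK si XYZ YZ])
  have pair: "(\<lambda>\<omega>. (\<xi> \<omega>, sK \<omega>)) \<in> M \<rightarrow>\<^sub>M N \<Otimes>\<^sub>M borel"
    using xi sK by simp
  have y: "(\<lambda>\<omega>. G (\<xi> \<omega>) (sK \<omega>)) \<in> borel_measurable M"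
    using measurable_compose[OF pair G] by simp
  have "prob ((\<lambda>\<omega>. G (\<xi> \<omega>) (sK \<omega>)) -` B \<inter> space M \<inter> ((\<lambda>\<omega>. s \<omega> $ i) -` C \<inter> space M))
      = prob ((\<lambda>\<omega>. G (\<xi> \<omega>) (sK \<omega>)) -` B \<inter> space M) * prob ((\<lambda>\<omega>. s \<omega> $ i) -` C \<inter> space M)"
    if B: "B \<in> sets borel" and C: "C \<in> sets borel" for B C
  proof (rule indep_setD[OF ind3])
    have "(\<lambda>\<omega>. G (\<xi> \<omega>) (sK \<omega>)) -` B \<inter> space M
        = (\<lambda>\<omega>. (\<xi> \<omega>, sK \<omega>)) -` ((\<lambda>(c, x). G c x) -` B \<inter> space (N \<Otimes>\<^sub>M borel)) \<inter> space M"
      using measurable_space[OF pair] by auto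
    then show "(\<lambda>\<omega>. G (\<xi> \<omega>) (sK \<omega>)) -` B \<inter> space M
        \<in> {(\<lambda>\<omega>. (\<xi> \<omega>, sK \<omega>)) -` D \<inter> space M | D. D \<in> sets (N \<Otimes>\<^sub>M borel)}"
      using measurable_sets[OF G B] by blast
  qed (use C in blast)
  then have "indep_set {(\<lambda>\<omega>. G (\<xi> \<omega>) (sK \<omega>)) -` B \<inter> space M | B. B \<in> sets borel}
      {(\<lambda>\<omega>. s \<omega> $ i) -` C \<inter> space M | C. C \<in> sets borel}"
    by (intro indep_setI) (use measurable_sets[OF y] measurable_sets[OF si] in auto)
  moreover have sig: "sigma_sets (space M) {Z -` C \<inter> space M | C. C \<in> sets borel}
      = {Z -` C \<inter> space M | C. C \<in> sets borel}" for Z :: "'a \<Rightarrow> real"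
    using sigma_sets_vimage_commute[of Z "space M" UNIV "sets borel"]
    using sets.sigma_sets_eq[of "borel :: real measure"] by simp
  ultimately show ?thesis
    unfolding indep_var_eq sig using y si by (simp add: sK_def)
qed

end

section \<open>Optimality of the vector of active moments\<close>

theorem corollary3p13:
  fixes M :: "'a measure" and N :: "'c measure"
    and s :: "'a \<Rightarrow> real ^ 'd" and k :: "'s::finite \<Rightarrow> 'd"
    and \<xi> :: "'a \<Rightarrow> 'c" and G :: "'c \<Rightarrow> real ^ 's \<Rightarrow> real"
    and y :: "'a \<Rightarrow> real" and T :: "(real ^ 'd) set"
    and \<mu> :: "'s \<Rightarrow> real" and z\<^sub>0 :: "real ^ 'd"
  assumes "prob_space M"
    and "sub_gaussian_vec M s" and "centered M s" and "isotropic M s"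
    and "inj k"
    and "indep_elements M N \<xi> borel s"
    and "(\<lambda>(c, x). G c x) \<in> borel_measurable (N \<Otimes>\<^sub>M borel)"
    and "y = (\<lambda>\<omega>. G (\<xi> \<omega>) (\<chi> j. s \<omega> $ k j))"
    and "sub_gaussian M y"
    and "T = span (range (\<lambda>j. axis (k j) 1))"
    and "\<mu> = (\<lambda>j. \<integral>\<omega>. y \<omega> * s \<omega> $ k j \<partial>M)"
    and "z\<^sub>0 = (\<Sum>j\<in>UNIV. \<mu> j *\<^sub>R axis (k j) 1)"
  shows "T = {z. vec_supp z \<subseteq> range k}
    \<and> z\<^sub>0 \<in> T
    \<and> (\<forall>z\<in>T. mismatch_cov M s y z\<^sub>0 \<le> mismatch_cov M s y z)
    \<and> mismatch_cov M s y z\<^sub>0 = norm (\<integral>\<omega>. y \<omega> *\<^sub>R orth_proj_perp T (s \<omega>) \<partial>M)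
    \<and> (prob_space.indep_vars M (\<lambda>_. borel) (\<lambda>i \<omega>. s \<omega> $ i) UNIV
        \<longrightarrow> mismatch_cov M s y z\<^sub>0 = 0)"
proof -
  interpret prob_space M by fact
  define m where "m = (\<integral>\<omega>. y \<omega> *\<^sub>R s \<omega> \<partial>M)"
  note iso = \<open>isotropic M s\<close>
  have y: "y \<in> borel_measurable M"
    using \<open>sub_gaussian M y\<close> by (simp add: sub_gaussian_def)
  have y2: "integrable M (\<lambda>\<omega>. (y \<omega>)\<^sup>2)"
    using \<open>sub_gaussian M y\<close> by (rule sub_gaussian_imp_square_integrable)
  have si: "has_bochner_integral M (\<lambda>\<omega>. s \<omega> $ i) 0" for i
    using has_bochner_integral_vec_nth[OF \<open>centered M s\<close>[unfolded centered_def], of i] by simp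
  have s2: "integrable M (\<lambda>\<omega>. (s \<omega> $ i)\<^sup>2)" for i
    using integrable.intros[OF isotropic_moments[OF iso, of i i]] by (simp add: power2_eq_square)
  have ys: "integrable M (\<lambda>\<omega>. y \<omega> * s \<omega> $ i)" for i
    by (rule integrable_mult_of_square_integrable[OF y _ y2 s2])
      (rule borel_measurable_has_bochner_integral[OF si])
  have m_nth: "m $ i = (\<integral>\<omega>. y \<omega> * s \<omega> $ i \<partial>M)" for i
    unfolding m_def by (subst integral_vec_nth) (simp_all add: ys)
  have T: "T = {z. vec_supp z \<subseteq> range k}"
    using assms(10) span_axes_eq_supported[of k] by simp
  have z0_nth: "z\<^sub>0 $ i = (if i \<in> range k then m $ i else 0)" for i
  proof (cases "i \<in> range k")
    case True
    then obtain j where "i = k j" by blast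
    then have "z\<^sub>0 $ i = (\<Sum>l\<in>UNIV. if j = l then \<mu> l else 0)"
      using \<open>inj k\<close> unfolding assms(12)
      by (simp add: axis_def inj_eq if_distrib cong: if_cong)
    with \<open>i = k j\<close> show ?thesis
      by (simp add: m_nth assms(11))
  next
    case False
    then show ?thesis
      unfolding assms(12) by (auto simp: axis_def intro!: sum.neutral)
  qed
  have z0_T: "z\<^sub>0 \<in> T"
    by (auto simp: T vec_supp_def z0_nth split: if_splits)
  have \<rho>: "mismatch_cov M s y z = norm (m - z)" for z
    unfolding m_def by (rule mismatch_cov_eq_distance[OF iso ys])
  (* On T, changing z only affects active coordinates of m - z, and z0 makes all of those vanish. *)
  have min: "mismatch_cov M s y z\<^sub>0 \<le> mismatch_cov M s y z" if "z \<in> T" for z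
  proof -
    have "z $ i = 0" if "i \<notin> range k" for i
      using \<open>z \<in> T\<close> that by (auto simp: T vec_supp_def)
    then show ?thesis
      unfolding \<rho> by (intro norm_le_componentwise_cart) (simp add: z0_nth)
  qed
  have perp: "(\<integral>\<omega>. y \<omega> *\<^sub>R orth_proj_perp T (s \<omega>) \<partial>M) = m - z\<^sub>0"
  proof -
    have int: "integrable M (\<lambda>\<omega>. (y \<omega> *\<^sub>R orth_proj_perp T (s \<omega>)) $ i)" for i
      unfolding T orth_proj_perp_supported using ys by (cases "i \<in> range k") simp_all
    have "(\<integral>\<omega>. y \<omega> *\<^sub>R orth_proj_perp T (s \<omega>) \<partial>M) $ i = (m - z\<^sub>0) $ i" for i
      unfolding integral_vec_nth[OF int] unfolding T orth_proj_perp_supported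
      by (cases "i \<in> range k") (simp_all add: m_nth z0_nth)
    then show ?thesis by (simp add: vec_eq_iff)
  qed
  have indep: "mismatch_cov M s y z\<^sub>0 = 0"
    if feat: "indep_vars (\<lambda>_. borel) (\<lambda>i \<omega>. s \<omega> $ i) UNIV"
  proof -
    have "m $ i = 0" if "i \<notin> range k" for i
    proof -
      have "indep_var borel y borel (\<lambda>\<omega>. s \<omega> $ i)"
        unfolding assms(8) by (rule indep_response_inactive_feature) fact+
      moreover have "integrable M y"
        by (rule square_integrable_imp_integrable[OF y y2])
      ultimately have "m $ i = (\<integral>\<omega>. y \<omega> \<partial>M) * (\<integral>\<omega>. s \<omega> $ i \<partial>M)"
        unfolding m_nth using integrable.intros[OF si]
        by (intro indep_var_lebesgue_integral)
      then show ?thesis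
        using has_bochner_integral_integral_eq[OF si] by simp
    qed
    then have "m = z\<^sub>0" by (simp add: vec_eq_iff z0_nth)
    then show ?thesis by (simp add: \<rho>)
  qed
  show ?thesis
    using T z0_T min perp indep by (simp add: \<rho>)
qed

end
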